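(* Let $h\in\mathbb{R}$ be a constant, let $M:\mathbb{R}\to \mathrm{Sp}(2n)$ be smooth, and let $\varphi$ be the map on $T^*\mathbb{R}^n\times\mathbb{R}\cong\mathbb{R}^{2n}\times\mathbb{R}$ given by $$\varphi(y,t)=\bigl(M(t)y,\; t+h\bigr),\qquad y=(q,p)\in\mathbb{R}^{2n}.$$ Then $(\psi,\varphi)$ is a canonical transformation, where $\psi = (\varphi\circ\mu,\; u+W\circ\mu)$, i.e. $\psi(y,t,u)=\bigl(M(t)y,\;t+h,\;u+W(y,t)\bigr)$, with $$W(y,t)=\tfrac12\, y^{\mathrm T} M(t)^{\mathrm T}\,\mathrm{J}_n\, M'(t)\, y.$$
   Context: $\mathrm{J}_n=\begin{bmatrix}0&\mathrm{I}_n\\-\mathrm{I}_n&0\end{bmatrix}$, and $\mathrm{Sp}(2n)$ is the group of real $2n\times2n$ matrices $S$ with $S^{\mathrm T}\mathrm{J}_nS=\mathrm{J}_n$. $M'(t)$ is the derivative of $M$ with respect to $t$. Points of the extended phase space $T^*(\mathbb{R}^n\times\mathbb{R})$ are written $(q,p,t,u)$ with $q,p\in\mathbb{R}^n$, $t,u\in\mathbb{R}$ ($u$ dual to $t$), and $\mu:T^*(\mathbb{R}^n\times\mathbb{R})\to T^*\mathbb{R}^n\times\mathbb{R}$ is the projection $(q,p,t,u)\mapsto(q,p,t)$. The symplectic form on the extended phase space is $\Omega_0=\sum_i \mathrm{d}p_i\wedge \mathrm{d}q^i+\mathrm{d}u\wedge \mathrm{d}t$. A canonical transformation is a pair $(\psi,\varphi)$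 of diffeomorphisms, $\psi$ of $T^*(\mathbb{R}^n\times\mathbb{R})$ and $\varphi$ of $T^*\mathbb{R}^n\times\mathbb{R}$, such that (1) $\mu\circ\psi=\varphi\circ\mu$ and (2) $\psi^*\Omega_0=\Omega_0$. *)

theory Defs
  imports "HOL-Analysis.Analysis"
begin

text \<open>Maps of class \<open>C\<^sup>k\<close> on a whole normed space. In finite dimension, continuity of all iterated
  directional derivatives is the same as continuity of the iterated Frechet derivatives.\<close>

primrec C_class :: "nat \<Rightarrow> ('a::real_normed_vector \<Rightarrow> 'b::real_normed_vector) \<Rightarrow> bool" where
  "C_class 0 f \<longleftrightarrow> continuous_on UNIV f"
| "C_class (Suc k) f \<longleftrightarrow>
    (\<forall>x. f differentiable at x) \<and> (\<forall>v. C_class k (\<lambda>x. frechet_derivative f (at x) v))"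

definition smooth :: "('a::real_normed_vector \<Rightarrow> 'b::real_normed_vector) \<Rightarrow> bool" where
  "smooth f \<longleftrightarrow> (\<forall>k. C_class k f)"

definition diffeomorphism :: "('a::real_normed_vector \<Rightarrow> 'b::real_normed_vector) \<Rightarrow> bool" where
  "diffeomorphism f \<longleftrightarrow> bij f \<and> smooth f \<and> smooth (inv f)"

text \<open>Phase space \<open>T\<^sup>*\<real>\<^sup>n\<close> is \<open>\<real>\<^sup>2\<^sup>n\<close>, with coordinates indexed by \<open>'n + 'n\<close>: a point \<open>y = (q, p)\<close>
  has \<open>q\<^sup>i\<close> at index \<open>Inl i\<close> and \<open>p\<^sub>i\<close> at index \<open>Inr i\<close>.\<close>

type_synonym 'n phase = "real^('n + 'n)"
type_synonym 'n phase_time = "'n phase \<times> real"  \<comment> \<open>\<open>(y, t)\<close>\<close>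
type_synonym 'n ext_phase = "'n phase \<times> real \<times> real"  \<comment> \<open>\<open>(y, t, u)\<close>\<close>

definition q_coord :: "'n::finite \<Rightarrow> 'n ext_phase \<Rightarrow> real" where
  "q_coord i = (\<lambda>(y, t, u). y $ Inl i)"

definition p_coord :: "'n::finite \<Rightarrow> 'n ext_phase \<Rightarrow> real" where
  "p_coord i = (\<lambda>(y, t, u). y $ Inr i)"

definition t_coord :: "'n::finite ext_phase \<Rightarrow> real" where
  "t_coord = (\<lambda>(y, t, u). t)"

definition u_coord :: "'n::finite ext_phase \<Rightarrow> real" where
  "u_coord = (\<lambda>(y, t, u). u)"

definition ext_proj :: "'n::finite ext_phase \<Rightarrow> 'n phase_time" where
  "ext_proj = (\<lambda>(y, t, u). (y, t))"

text \<open>A differential 1-form on a vector space takes a base point and one tangent vector, a 2-form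
  a base point and two tangent vectors.\<close>

type_synonym 'a one_form = "'a \<Rightarrow> 'a \<Rightarrow> real"
type_synonym 'a two_form = "'a \<Rightarrow> 'a \<Rightarrow> 'a \<Rightarrow> real"

definition differential :: "('a::real_normed_vector \<Rightarrow> real) \<Rightarrow> 'a one_form" where
  "differential f x v = frechet_derivative f (at x) v"

definition wedge :: "'a one_form \<Rightarrow> 'a one_form \<Rightarrow> 'a two_form" where
  "wedge \<alpha> \<beta> x v w = \<alpha> x v * \<beta> x w - \<alpha> x w * \<beta> x v"

definition pullback ::
  "('a::real_normed_vector \<Rightarrow> 'b::real_normed_vector) \<Rightarrow> 'b two_form \<Rightarrow> 'a two_form" where
  "pullback f \<omega> x v w = \<omega> (f x) (frechet_derivative f (at x) v) (frechet_derivative f (at x) w)"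

definition Omega0 :: "'n::finite ext_phase two_form" where
  "Omega0 x v w =
     (\<Sum>i\<in>UNIV. wedge (differential (p_coord i)) (differential (q_coord i)) x v w)
     + wedge (differential u_coord) (differential t_coord) x v w"

definition canonical_transformation ::
  "('n::finite ext_phase \<Rightarrow> 'n ext_phase) \<Rightarrow> ('n phase_time \<Rightarrow> 'n phase_time) \<Rightarrow> bool" where
  "canonical_transformation \<psi> \<phi> \<longleftrightarrow>
     diffeomorphism \<psi> \<and> diffeomorphism \<phi> \<and>
     ext_proj \<circ> \<psi> = \<phi> \<circ> ext_proj \<and> pullback \<psi> Omega0 = Omega0"

definition J_mat :: "real^('n::finite + 'n)^('n + 'n)" where
  "J_mat = (\<chi> a b. case (a, b) of
      (Inl i, Inr j) \<Rightarrow> (if i = j then 1 else 0)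
    | (Inr i, Inl j) \<Rightarrow> (if i = j then - 1 else 0)
    | _ \<Rightarrow> 0)"

definition Sp :: "(real^('n::finite + 'n)^('n + 'n)) set" where
  "Sp = {S. transpose S ** J_mat ** S = J_mat}"

end

theory Submission
  imports Defs
begin

text \<open>Let \<open>\<omega>(x, y) = x \<bullet> J y\<close> (\<open>symp_form\<close> below). On the phase space component the form
  \<open>\<Omega>\<^sub>0\<close> is \<open>- \<omega>\<close>, so \<open>\<Omega>\<^sub>0\<close> evaluated at \<open>(a, s, c)\<close> and \<open>(b, r, d)\<close> is
  \<open>- \<omega>(a, b) + c r - d s\<close>. The derivative of \<open>\<psi>\<close> at \<open>(y, t, u)\<close>
  sends \<open>(a, s, c)\<close> to \<open>(M a + s M' y, s, c + dW(a, s))\<close>. Because \<open>M(t)\<close> preserves \<open>\<omega>\<close>, the spatial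
  part contributes \<open>- \<omega>(a, b)\<close>, the vanishing term \<open>- s r \<omega>(M' y, M' y)\<close>, and the mixed terms
  \<open>- r \<omega>(M a, M' y) + s \<omega>(M b, M' y)\<close>. The mixed terms must be cancelled by
  \<open>r dW(a, s) - s dW(b, r)\<close>, so it is enough that
  \<open>dW(a, s) = \<omega>(M a, M' y) + s k\<close> for some \<open>k\<close> independent of \<open>(a, s)\<close>. Now
  \<open>W(y, t) = \<omega>(M y, M' y) / 2\<close> is a quadratic form in \<open>y\<close>, and its derivative has this form
  because the bilinear form \<open>\<omega>(M y, M' z)\<close> is symmetric in \<open>y, z\<close>. The symmetry is the derivative
  of the identity \<open>\<omega>(M(t) y, M(t) z) = \<omega>(y, z)\<close> with respect to \<open>t\<close>, together with antisymmetry of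
  \<open>\<omega>\<close> (\<open>symp_derivative_symmetric\<close>): it says that \<open>M\<^sup>T J M'\<close> is a symmetric matrix.

  That the maps are diffeomorphisms is a matter of writing the inverses down. Since \<open>J\<^sup>2 = - I\<close>, the
  inverse of a symplectic matrix \<open>S\<close> is \<open>- J S\<^sup>T J\<close>, which depends linearly on \<open>S\<close>; hence both maps
  and both inverses are built from \<open>M\<close>, \<open>M'\<close> and affine maps by bilinear products alone. Smoothness
  therefore reduces to its closure under these operations.\<close>

section \<open>Smooth maps\<close>

lemma C_class_SucI:
  assumes "\<And>x. (f has_derivative f' x) (at x)" "\<And>v. C_class k (\<lambda>x. f' x v)"
  shows "C_class (Suc k) f"
proof -
  have "frechet_derivative f (at x) = f' x" for x
    using assms(1) frechet_derivative_at by metis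
  then show ?thesis using assms by (auto simp: differentiable_def)
qed

lemma C_class_SucD:
  assumes "C_class (Suc k) f"
  shows "(f has_derivative frechet_derivative f (at x)) (at x)"
    and "C_class k (\<lambda>x. frechet_derivative f (at x) v)"
  using assms by (auto simp: frechet_derivative_works)

lemma C_class_Suc_imp: "C_class (Suc k) f \<Longrightarrow> C_class k f"
proof (induction k arbitrary: f)
  case 0
  then show ?case
    by (auto intro!: continuous_at_imp_continuous_on differentiable_imp_continuous_within)
next
  case (Suc k)
  then show ?case by (metis C_class.simps(2))
qed

lemma C_class_const: "C_class k (\<lambda>x. c)"
proof (induction k arbitrary: c)
  case (Suc k)
  then show ?case by (intro C_class_SucI[where f' = "\<lambda>x v. 0"]) auto
qed simp

lemma C_class_bounded_linear: "bounded_linear f \<Longrightarrow> C_class k f"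
  by (cases k) (auto simp del: C_class.simps(2) intro!: C_class_SucI[where f' = "\<lambda>x. f"]
      C_class_const linear_continuous_on bounded_linear_imp_has_derivative)

lemma C_class_add:
  "C_class k f \<Longrightarrow> C_class k g \<Longrightarrow> C_class k (\<lambda>x. f x + g x)"
proof (induction k arbitrary: f g)
  case 0
  then show ?case by (auto intro: continuous_on_add)
next
  case (Suc k)
  show ?case
    by (rule C_class_SucI[OF has_derivative_add[OF C_class_SucD(1)[OF Suc.prems(1)]
            C_class_SucD(1)[OF Suc.prems(2)]]])
      (rule Suc.IH[OF C_class_SucD(2)[OF Suc.prems(1)] C_class_SucD(2)[OF Suc.prems(2)]])
qed

lemma C_class_Pair:
  "C_class k f \<Longrightarrow> C_class k g \<Longrightarrow> C_class k (\<lambda>x. (f x, g x))"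
proof (induction k arbitrary: f g)
  case 0
  then show ?case by (auto intro: continuous_on_Pair)
next
  case (Suc k)
  show ?case
    by (rule C_class_SucI[OF has_derivative_Pair[OF C_class_SucD(1)[OF Suc.prems(1)]
            C_class_SucD(1)[OF Suc.prems(2)]]])
      (rule Suc.IH[OF C_class_SucD(2)[OF Suc.prems(1)] C_class_SucD(2)[OF Suc.prems(2)]])
qed

lemma C_class_bounded_linear_compose:
  assumes "bounded_linear L"
  shows "C_class k f \<Longrightarrow> C_class k (\<lambda>x. L (f x))"
proof (induction k arbitrary: f)
  case 0
  then show ?case by (auto intro: bounded_linear.continuous_on[OF assms])
next
  case (Suc k)
  show ?case
    by (rule C_class_SucI[OF bounded_linear.has_derivative[OF assms C_class_SucD(1)[OF Suc.prems]]])
      (rule Suc.IH[OF C_class_SucD(2)[OF Suc.prems]])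
qed

text \<open>The product rule turns a directional derivative of a bilinear product into two products in
  which one factor has been differentiated and the other has only been weakened to class \<open>C\<^sup>k\<close>.\<close>

lemma C_class_bilinear:
  assumes "bounded_bilinear B"
  shows "C_class k f \<Longrightarrow> C_class k g \<Longrightarrow> C_class k (\<lambda>x. B (f x) (g x))"
proof (induction k arbitrary: f g)
  case 0
  then show ?case by (auto intro: bounded_bilinear.continuous_on[OF assms])
next
  case (Suc k)
  show ?case
  proof (rule C_class_SucI)
    show "((\<lambda>x. B (f x) (g x)) has_derivative
        (\<lambda>v. B (f x) (frechet_derivative g (at x) v) + B (frechet_derivative f (at x) v) (g x)))
        (at x)" for x
      by (rule bounded_bilinear.FDERIV[OF assms C_class_SucD(1)[OF Suc.prems(1)]
            C_class_SucD(1)[OF Suc.prems(2)]])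
    show "C_class k (\<lambda>x. B (f x) (frechet_derivative g (at x) v)
        + B (frechet_derivative f (at x) v) (g x))" for v
      using Suc.prems by (intro C_class_add Suc.IH) (auto intro: C_class_Suc_imp C_class_SucD(2))
  qed
qed

text \<open>The derivative of an affine map is constant, so a directional derivative of the composite is
  again a directional derivative of \<open>f\<close>, in the fixed direction \<open>L v\<close>, composed with that map.\<close>

lemma C_class_compose_affine:
  assumes "bounded_linear L"
  shows "C_class k f \<Longrightarrow> C_class k (\<lambda>x. f (L x + c))"
proof (induction k arbitrary: f)
  case 0
  have "continuous_on UNIV (\<lambda>x. L x + c)"
    by (intro continuous_on_add continuous_on_const linear_continuous_on assms)
  then show ?case
    using 0 by (auto intro: continuous_on_compose2[where f = "\<lambda>x. L x + c" and t = UNIV])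
next
  case (Suc k)
  show ?case
  proof (rule C_class_SucI)
    fix x
    have "((\<lambda>x. L x + c) has_derivative L) (at x)"
      using bounded_linear_imp_has_derivative[OF assms] by (rule has_derivative_add_const)
    then show "((\<lambda>x. f (L x + c)) has_derivative
        (\<lambda>v. frechet_derivative f (at (L x + c)) (L v))) (at x)"
      by (rule has_derivative_compose[OF _ C_class_SucD(1)[OF Suc.prems]])
  next
    show "C_class k (\<lambda>x. frechet_derivative f (at (L x + c)) (L v))" for v
      using Suc.IH[OF C_class_SucD(2)[OF Suc.prems]] .
  qed
qed

lemma smooth_has_derivative:
  "smooth f \<Longrightarrow> (f has_derivative frechet_derivative f (at x)) (at x)"
  unfolding smooth_def using C_class_SucD(1) by blast

lemma smooth_has_vector_derivative:
  "smooth f \<Longrightarrow> (f has_vector_derivative vector_derivative f (at t)) (at t)"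
  using smooth_has_derivative[of f t] vector_derivative_works differentiable_def by blast

lemma smooth_vector_derivative: "smooth f \<Longrightarrow> smooth (\<lambda>t. vector_derivative f (at t))"
proof -
  assume f: "smooth f"
  have "vector_derivative f (at t) = frechet_derivative f (at t) 1" for t
    using frechet_derivative_at[OF smooth_has_vector_derivative[OF f,
          unfolded has_vector_derivative_def], of t]
    by (metis scale_one)
  then show ?thesis
    using f C_class_SucD(2)[of _ f 1] by (simp add: smooth_def del: C_class.simps)
qed

lemma smooth_const: "smooth (\<lambda>x. c)"
  by (simp add: smooth_def C_class_const)

lemma smooth_bounded_linear: "bounded_linear f \<Longrightarrow> smooth f"
  by (simp add: smooth_def C_class_bounded_linear)

lemma smooth_bounded_linear_compose:
  "bounded_linear L \<Longrightarrow> smooth f \<Longrightarrow> smooth (\<lambda>x. L (f x))"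
  by (simp add: smooth_def C_class_bounded_linear_compose)

lemma smooth_add: "smooth f \<Longrightarrow> smooth g \<Longrightarrow> smooth (\<lambda>x. f x + g x)"
  by (simp add: smooth_def C_class_add)

lemma smooth_Pair: "smooth f \<Longrightarrow> smooth g \<Longrightarrow> smooth (\<lambda>x. (f x, g x))"
  by (simp add: smooth_def C_class_Pair)

lemma smooth_bilinear:
  "bounded_bilinear B \<Longrightarrow> smooth f \<Longrightarrow> smooth g \<Longrightarrow> smooth (\<lambda>x. B (f x) (g x))"
  by (simp add: smooth_def C_class_bilinear)

lemma smooth_compose_affine:
  "smooth f \<Longrightarrow> bounded_linear L \<Longrightarrow> smooth (\<lambda>x. f (L x + c))"
  by (simp add: smooth_def C_class_compose_affine)

lemma diffeomorphismI:
  assumes "smooth f" "smooth g" "\<And>x. g (f x) = x" "\<And>y. f (g y) = y"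
  shows "diffeomorphism f"
proof -
  have "bij f" using assms(3,4) by (intro o_bij[of g]) auto
  moreover have "inv f = g" using assms(3,4) by (intro inv_equality) auto
  ultimately show ?thesis using assms by (simp add: diffeomorphism_def)
qed

lemma bounded_bilinear_matrix_vector_mult:
  "bounded_bilinear ((*v) :: real^'n^'m \<Rightarrow> real^'n \<Rightarrow> real^'m)"
  by (simp add: bilinear_conv_bounded_bilinear[symmetric] bilinear_def linear_iff
      matrix_vector_mult_add_rdistrib scaleR_matrix_vector_assoc
      matrix_vector_right_distrib matrix_vector_mult_scaleR)

lemma bounded_bilinear_matrix_matrix_mult:
  "bounded_bilinear ((**) :: real^'n^'m \<Rightarrow> real^'k^'n \<Rightarrow> real^'k^'m)"
  by (simp add: bilinear_conv_bounded_bilinear[symmetric] bilinear_def linear_iff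
      vec_eq_iff matrix_matrix_mult_def sum.distrib ring_distribs sum_distrib_left mult_ac)

lemma bounded_linear_transpose: "bounded_linear (transpose :: real^'n^'m \<Rightarrow> real^'m^'n)"
  by (simp add: linear_conv_bounded_linear[symmetric] linear_iff transpose_def vec_eq_iff)

section \<open>The symplectic form on phase space\<close>

definition symp_form :: "'n::finite phase \<Rightarrow> 'n phase \<Rightarrow> real" where
  "symp_form x y = x \<bullet> (J_mat *v y)"

lemma bounded_bilinear_symp_form: "bounded_bilinear symp_form"
  unfolding symp_form_def
  by (rule bounded_bilinear.comp[OF bounded_bilinear_inner bounded_linear_ident
        matrix_vector_mul_bounded_linear])

lemma sum_UNIV_Plus:
  "(\<Sum>k\<in>UNIV. f k) = (\<Sum>i\<in>UNIV. f (Inl i)) + (\<Sum>i\<in>UNIV. f (Inr i))"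
  for f :: "'a::finite + 'b::finite \<Rightarrow> 'c::comm_monoid_add"
  by (simp add: UNIV_Plus_UNIV[symmetric] sum.Plus del: UNIV_Plus_UNIV)

lemma J_mat_mult_nth:
  "(J_mat *v y) $ Inl i = y $ Inr i" "(J_mat *v y) $ Inr i = - y $ Inl i"
  by (simp_all add: J_mat_def matrix_vector_mult_def sum_UNIV_Plus if_distrib[of "\<lambda>c. c * _"]
      cong: if_cong)

lemma J_mat_J_mat: "J_mat *v (J_mat *v y) = - y"
proof -
  have "(J_mat *v (J_mat *v y)) $ k = (- y) $ k" for k
    by (cases k) (simp_all add: J_mat_mult_nth)
  then show ?thesis by (simp add: vec_eq_iff)
qed

lemma symp_form_eq: "symp_form x y = (\<Sum>i\<in>UNIV. x $ Inl i * y $ Inr i - x $ Inr i * y $ Inl i)"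
  by (simp add: symp_form_def inner_vec_def sum_UNIV_Plus J_mat_mult_nth sum_subtractf sum_negf)

lemma symp_form_antisym: "symp_form x y = - symp_form y x"
  by (simp add: symp_form_eq sum_negf[symmetric] algebra_simps)

lemma inner_vector_matrix_mult: "x \<bullet> (y v* A) = (A *v x) \<bullet> y"
  for A :: "real^'n^'m"
  by (metis dot_lmul_matrix inner_commute)

lemma Sp_preserves_symp_form:
  assumes "S \<in> Sp"
  shows "symp_form (S *v x) (S *v y) = symp_form x y"
proof -
  have "symp_form (S *v x) (S *v y) = x \<bullet> ((transpose S ** J_mat ** S) *v y)"
    by (simp add: symp_form_def matrix_vector_mul_assoc[symmetric] inner_vector_matrix_mult)
  also have "\<dots> = symp_form x y"
    using assms by (simp add: symp_form_def Sp_def)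
  finally show ?thesis .
qed

text \<open>The candidate for the inverse is written as a linear expression in \<open>S\<close>, so that it depends
  smoothly on a smooth family of matrices.\<close>

definition symp_inv :: "real^('n::finite + 'n)^('n + 'n) \<Rightarrow> real^('n + 'n)^('n + 'n)" where
  "symp_inv S = - (J_mat ** transpose S ** J_mat)"

text \<open>Multiply \<open>S\<^sup>T J S = J\<close> by \<open>- J\<close> on the left and use \<open>J\<^sup>2 = - I\<close>; a left inverse of a
  square matrix is also a right inverse.\<close>

lemma symp_inv:
  assumes "S \<in> Sp"
  shows "symp_inv S *v (S *v x) = x" and "S *v (symp_inv S *v x) = x"
proof -
  have S: "(J_mat *v (S *v y)) v* S = J_mat *v y" for y
    unfolding transpose_matrix_vector[symmetric]
    using assms by (simp add: Sp_def matrix_vector_mul_assoc matrix_mul_assoc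
        del: transpose_matrix_vector)
  have left: "symp_inv S *v (S *v y) = y" for y
    by (simp add: symp_inv_def bounded_bilinear.minus_left[OF bounded_bilinear_matrix_vector_mult]
        matrix_vector_mul_assoc[symmetric] S J_mat_J_mat)
  then have "symp_inv S ** S = mat 1"
    by (simp add: matrix_eq matrix_vector_mul_assoc[symmetric])
  then have "S ** symp_inv S = mat 1" using matrix_left_right_inverse by blast
  then show "S *v (symp_inv S *v x) = x" by (simp add: matrix_vector_mul_assoc)
  show "symp_inv S *v (S *v x) = x" by (rule left)
qed

lemma bounded_linear_symp_inv: "bounded_linear symp_inv"
proof -
  note B = bounded_bilinear_matrix_matrix_mult
  have "bounded_linear (\<lambda>S. J_mat ** transpose S ** J_mat)"
    by (rule bounded_linear_compose[OF bounded_bilinear.bounded_linear_left[OF B]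
          bounded_linear_compose[OF bounded_bilinear.bounded_linear_right[OF B]
            bounded_linear_transpose]])
  then show ?thesis
    unfolding symp_inv_def by (rule bounded_linear_minus)
qed

lemma differential_bounded_linear: "bounded_linear f \<Longrightarrow> differential f x v = f v"
  unfolding differential_def
  using frechet_derivative_at[OF bounded_linear_imp_has_derivative] by metis

lemma Omega0_eq:
  "Omega0 x (a, s, c) (b, r, d) = - symp_form a b + c * r - d * s"
proof -
  have q: "bounded_linear (q_coord i)" and p: "bounded_linear (p_coord i)" for i :: 'a
    unfolding q_coord_def p_coord_def
    by (simp_all add: split_def bounded_linear_fst bounded_linear_compose[OF bounded_linear_vec_nth])
  have t: "bounded_linear (t_coord :: 'a ext_phase \<Rightarrow> real)"
    and u: "bounded_linear (u_coord :: 'a ext_phase \<Rightarrow> real)"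
    unfolding t_coord_def u_coord_def
    by (simp_all add: split_def bounded_linear_fst_comp bounded_linear_snd_comp bounded_linear_snd)
  show ?thesis
    unfolding Omega0_def wedge_def symp_form_eq
    by (simp add: differential_bounded_linear q p t u)
      (simp add: q_coord_def p_coord_def t_coord_def u_coord_def sum_negf[symmetric] mult.commute)
qed

section \<open>Curves of symplectic matrices\<close>

text \<open>The derivative in \<open>t\<close> of the constant \<open>symp_form (M t *v y) (M t *v z)\<close> vanishes;
  antisymmetry of \<open>symp_form\<close> turns this into the symmetry of \<open>M\<^sup>T J M'\<close>.\<close>

lemma symp_derivative_symmetric:
  assumes M: "(M has_vector_derivative M') (at t)" and Sp: "\<And>t. M t \<in> Sp"
  shows "symp_form (M t *v y) (M' *v z) = symp_form (M t *v z) (M' *v y)"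
proof -
  have deriv: "((\<lambda>t. M t *v x) has_vector_derivative M' *v x) (at t)" for x
    by (rule bounded_linear.has_vector_derivative[OF
          bounded_bilinear.bounded_linear_left[OF bounded_bilinear_matrix_vector_mult] M])
  have "((\<lambda>t. symp_form (M t *v y) (M t *v z)) has_vector_derivative
      symp_form (M t *v y) (M' *v z) + symp_form (M' *v y) (M t *v z)) (at t)"
    by (rule bounded_bilinear.has_vector_derivative[OF bounded_bilinear_symp_form deriv deriv])
  moreover have "(\<lambda>t. symp_form (M t *v y) (M t *v z)) = (\<lambda>t. symp_form y z)"
    using Sp_preserves_symp_form[OF Sp] by auto
  ultimately have "symp_form (M t *v y) (M' *v z) + symp_form (M' *v y) (M t *v z) = 0"
    using vector_derivative_unique_at has_vector_derivative_const by metis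
  then show ?thesis using symp_form_antisym[of "M' *v y" "M t *v z"] by simp
qed

lemma has_derivative_curve_mult:
  fixes M :: "real \<Rightarrow> real^'n^'m"
  assumes "(M has_vector_derivative M') (at (snd p))"
  shows "((\<lambda>p. M (snd p) *v fst p) has_derivative
    (\<lambda>(a, s). M (snd p) *v a + s *\<^sub>R (M' *v fst p))) (at p)"
proof -
  have "((\<lambda>p. M (snd p)) has_derivative (\<lambda>v. snd v *\<^sub>R M')) (at p)"
    using has_derivative_compose[OF has_derivative_snd[OF has_derivative_ident]
        assms[unfolded has_vector_derivative_def]] by simp
  from bounded_bilinear.FDERIV[OF bounded_bilinear_matrix_vector_mult this
      has_derivative_fst[OF has_derivative_ident]]
  show ?thesis
    by (simp add: split_def scaleR_matrix_vector_assoc)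
qed

text \<open>Only the part of the derivative along \<open>y\<close> matters: in the pullback of \<open>\<Omega>\<^sub>0\<close> the summand
  \<open>s * c\<close> is a multiple of \<open>dt\<close> and dies in the wedge product with \<open>dt\<close>. The symmetry of the
  quadratic form \<open>W\<close> produces a factor \<open>2\<close> that cancels the factor \<open>1/2\<close>.\<close>

lemma has_derivative_generating_function:
  assumes M: "smooth M" and Sp: "\<And>t. M t \<in> Sp"
  defines "M' \<equiv> \<lambda>t. vector_derivative M (at t)"
  shows "\<exists>c. ((\<lambda>p. 1/2 * symp_form (M (snd p) *v fst p) (M' (snd p) *v fst p)) has_derivative
    (\<lambda>(a, s). symp_form (M t *v a) (M' t *v y) + s * c)) (at (y, t))"
proof -
  define M'' where "M'' = vector_derivative M' (at t)"
  have dM: "(M has_vector_derivative M' t) (at (snd (y, t)))"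
    unfolding M'_def by (simp add: smooth_has_vector_derivative[OF M])
  have dM': "(M' has_vector_derivative M'') (at (snd (y, t)))"
    unfolding M'_def M''_def
    by (simp add: smooth_has_vector_derivative[OF smooth_vector_derivative[OF M]])
  interpret form: bounded_bilinear symp_form by (rule bounded_bilinear_symp_form)
  have sym: "symp_form (M t *v y) (M' t *v z) = symp_form (M t *v z) (M' t *v y)" for z
    using symp_derivative_symmetric[OF _ Sp] dM by simp
  have self: "symp_form (M' t *v y) (M' t *v y) = 0"
    using symp_form_antisym[of "M' t *v y" "M' t *v y"] by simp
  have "((\<lambda>p. 1/2 * symp_form (M (snd p) *v fst p) (M' (snd p) *v fst p)) has_derivative
    (\<lambda>(a, s). symp_form (M t *v a) (M' t *v y) + s * (1/2 * symp_form (M t *v y) (M'' *v y)))) (at (y, t))"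
    by (rule has_derivative_eq_rhs[OF has_derivative_mult_right[OF
            form.FDERIV[OF has_derivative_curve_mult[OF dM] has_derivative_curve_mult[OF dM']]]])
      (auto simp: fun_eq_iff form.add_left form.add_right form.scaleR_left form.scaleR_right
        sym self field_simps)
  then show ?thesis by blast
qed

theorem corollary4p1:
  fixes h :: real
    and M :: "real \<Rightarrow> real^('n::finite + 'n)^('n + 'n)"
    and W :: "'n phase_time \<Rightarrow> real"
    and \<phi> :: "'n phase_time \<Rightarrow> 'n phase_time"
    and \<psi> :: "'n ext_phase \<Rightarrow> 'n ext_phase"
  assumes "smooth M"
    and "\<And>t. M t \<in> Sp"
    and "\<And>y t. \<phi> (y, t) = (M t *v y, t + h)"
    and "\<And>y t. W (y, t) =
           1/2 * (y \<bullet> ((transpose (M t) ** J_mat ** vector_derivative M (at t)) *v y))"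
    and "\<And>y t u. \<psi> (y, t, u) = (M t *v y, t + h, u + W (y, t))"
  shows "canonical_transformation \<psi> \<phi>"
proof -
  note M = assms(1) and Sp = assms(2) and phi = assms(3) and psi = assms(5)
  define M' where "M' t = vector_derivative M (at t)" for t
  have dM: "(M has_vector_derivative M' t) (at t)" for t
    unfolding M'_def by (rule smooth_has_vector_derivative[OF M])
  have M': "smooth M'"
    unfolding M'_def[abs_def] by (rule smooth_vector_derivative[OF M])
  have W: "W p = 1/2 * symp_form (M (snd p) *v fst p) (M' (snd p) *v fst p)" for p
    by (cases p)
      (simp add: assms(4) M'_def symp_form_def matrix_vector_mul_assoc[symmetric] inner_vector_matrix_mult)
  define N where "N t = symp_inv (M t)" for t
  have N: "smooth N"
    unfolding N_def[abs_def] by (rule smooth_bounded_linear_compose[OF bounded_linear_symp_inv M])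
  have NM: "N t *v (M t *v y) = y" and MN: "M t *v (N t *v y) = y" for t y
    unfolding N_def using symp_inv[OF Sp] by simp_all
  note mult = smooth_bilinear[OF bounded_bilinear_matrix_vector_mult smooth_compose_affine]
  have W_smooth: "smooth (\<lambda>x. W (Y x, L x + c))" if "smooth Y" "bounded_linear L"
    for Y :: "'n ext_phase \<Rightarrow> 'n phase" and L c
    unfolding W fst_conv snd_conv
    by (intro smooth_bounded_linear_compose[OF bounded_linear_mult_right]
        smooth_bilinear[OF bounded_bilinear_symp_form] mult M M' that)

  \<comment> \<open>The affine substitution rule produces arguments of the form \<open>L x + c\<close>, so the maps are brought
    into that shape, with \<open>c = 0\<close> or \<open>c = - h\<close>.\<close>
  note linear = bounded_linear_fst bounded_linear_snd
    bounded_linear_fst_comp[OF bounded_linear_snd] bounded_linear_snd_comp[OF bounded_linear_snd]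
  have phi_eq: "\<phi> = (\<lambda>p. (M (snd p + 0) *v fst p, snd p + h))"
    by (auto simp: fun_eq_iff phi)
  have "diffeomorphism \<phi>"
  proof (rule diffeomorphismI)
    show "smooth \<phi>"
      unfolding phi_eq
      by (intro smooth_Pair mult smooth_add M smooth_const smooth_bounded_linear linear)
    show "smooth (\<lambda>p. (N (snd p + - h) *v fst p, snd p + - h))"
      by (intro smooth_Pair mult smooth_add N smooth_const smooth_bounded_linear linear)
  qed (auto simp: phi NM MN)

  \<comment> \<open>The inverse of \<open>\<psi>\<close> first recovers \<open>(y, t)\<close> and then subtracts \<open>W\<close> evaluated there.\<close>
  let ?Z = "\<lambda>x :: 'n ext_phase. N (fst (snd x) + - h) *v fst x"
  have psi_eq: "\<psi> = (\<lambda>x. (M (fst (snd x) + 0) *v fst x, fst (snd x) + h,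
      snd (snd x) + W (fst x, fst (snd x) + 0)))"
    by (auto simp: fun_eq_iff psi)
  have "diffeomorphism \<psi>"
  proof (rule diffeomorphismI)
    show "smooth \<psi>"
      unfolding psi_eq
      by (intro smooth_Pair mult smooth_add W_smooth M smooth_const smooth_bounded_linear linear)
    show "smooth (\<lambda>x. (?Z x, fst (snd x) + - h,
        snd (snd x) + - 1 * W (?Z x, fst (snd x) + - h)))"
      by (intro smooth_Pair mult smooth_add smooth_bounded_linear_compose[OF bounded_linear_mult_right]
          W_smooth N smooth_const smooth_bounded_linear linear)
  qed (auto simp: psi NM MN)

  have pullback: "pullback \<psi> Omega0 x v w = Omega0 x v w" for x v w
  proof -
    obtain y t u where x: "x = (y, t, u)" by (cases x)
    obtain a s c where v: "v = (a, s, c)" by (cases v)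
    obtain b r d where w: "w = (b, r, d)" by (cases w)
    obtain k where "((\<lambda>p. 1/2 * symp_form (M (snd p) *v fst p) (M' (snd p) *v fst p)) has_derivative
        (\<lambda>(a, s). symp_form (M t *v a) (M' t *v y) + s * k)) (at (y, t))"
      using has_derivative_generating_function[OF M Sp, of t y] unfolding M'_def by (elim exE)
    then have dW: "(W has_derivative (\<lambda>(a, s). symp_form (M t *v a) (M' t *v y) + s * k)) (at (y, t))"
      unfolding W[symmetric] .
    have proj: "((\<lambda>x. (fst x, fst (snd x))) has_derivative (\<lambda>v. (fst v, fst (snd v)))) (at x)"
      by (auto intro!: derivative_eq_intros)
    have "((\<lambda>x. M (fst (snd x)) *v fst x) has_derivative
        (\<lambda>v. M t *v fst v + fst (snd v) *\<^sub>R (M' t *v y))) (at x)"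
      using has_derivative_compose[OF proj, where g = "\<lambda>p. M (snd p) *v fst p"
          and g' = "\<lambda>(a, s). M t *v a + s *\<^sub>R (M' t *v y)"]
        has_derivative_curve_mult[of M "M' t" "(y, t)"] dM by (simp add: x split_def)
    moreover have "((\<lambda>x. fst (snd x) + h) has_derivative (\<lambda>v. fst (snd v))) (at x)"
      by (auto intro!: derivative_eq_intros)
    moreover have "((\<lambda>x. snd (snd x)) has_derivative (\<lambda>v. snd (snd v))) (at x)"
      by (auto intro!: derivative_eq_intros)
    moreover have "((\<lambda>x. W (fst x, fst (snd x))) has_derivative
        (\<lambda>v. symp_form (M t *v fst v) (M' t *v y) + fst (snd v) * k)) (at x)"
      using has_derivative_compose[OF proj, where g = W
          and g' = "\<lambda>(a, s). symp_form (M t *v a) (M' t *v y) + s * k"] dW by (simp add: x split_def)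
    ultimately have "(\<psi> has_derivative (\<lambda>v. (M t *v fst v + fst (snd v) *\<^sub>R (M' t *v y), fst (snd v),
        snd (snd v) + (symp_form (M t *v fst v) (M' t *v y) + fst (snd v) * k)))) (at x)"
      unfolding psi_eq add_0_right by (intro has_derivative_Pair has_derivative_add)
    then have d: "frechet_derivative \<psi> (at x) =
        (\<lambda>v. (M t *v fst v + fst (snd v) *\<^sub>R (M' t *v y), fst (snd v),
          snd (snd v) + (symp_form (M t *v fst v) (M' t *v y) + fst (snd v) * k)))"
      by (rule frechet_derivative_at[symmetric])
    interpret form: bounded_bilinear symp_form by (rule bounded_bilinear_symp_form)
    \<comment> \<open>The first fact removes the \<open>s * r\<close> term; the second brings the mixed terms into the form
      that cancels against \<open>dW \<and> dt\<close>.\<close>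
    have self: "symp_form (M' t *v y) (M' t *v y) = 0"
      using symp_form_antisym[of "M' t *v y" "M' t *v y"] by simp
    have swap: "symp_form (M' t *v y) (M t *v b) = - symp_form (M t *v b) (M' t *v y)"
      by (rule symp_form_antisym)
    show ?thesis
      unfolding pullback_def d v w Omega0_eq fst_conv snd_conv
        form.add_left form.add_right form.scaleR_left form.scaleR_right
        Sp_preserves_symp_form[OF Sp] self swap
      by (simp add: algebra_simps)
  qed

  have "ext_proj \<circ> \<psi> = \<phi> \<circ> ext_proj"
    by (auto simp: ext_proj_def fun_eq_iff phi psi)
  moreover have "pullback \<psi> Omega0 = Omega0"
    using pullback by (intro ext)
  ultimately show ?thesis
    unfolding canonical_transformation_def
    using \<open>diffeomorphism \<phi>\<close> \<open>diffeomorphism \<psi>\<close> by blast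
qed

end
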